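(* Assume $\mathsf{AC}$ (so the theory is $\mathsf{ZFC}$). Then there exists a separable metrizable topological group that is not Effros.
   Context: All spaces and topological groups are separable and metrizable. "Group" means topological group, and all group actions $G\times X\to X$ of a group on a space are continuous. A space is non-meager if it is not a countable union of nowhere dense subsets of itself. An action of $G$ on $X$ is transitive if for all $x,y\in X$ there is $g\in G$ with $gx=y$. For $S\subseteq G$ and $x\in X$, $Sx=\{gx:g\in S\}$. The action is micro-transitive if $Ux$ is a neighborhood of $x$ in $X$ for every $x\in X$ and every neighborhood $U$ of the identity in $G$. A group $G$ is Effros if every transitive (continuous) action of $G$ on a non-meager (separable metrizable) space is micro-transitive. *)

theory Defs
  imports "HOL-Analysis.Analysis" "HOL-Algebra.Group_Action"
begin

definition separable_metrizable :: "'a topology \<Rightarrow> bool" where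
  "separable_metrizable X \<longleftrightarrow> separable_space X \<and> metrizable_space X"

definition nowhere_dense_in :: "'a topology \<Rightarrow> 'a set \<Rightarrow> bool" where
  "nowhere_dense_in X S \<longleftrightarrow> S \<subseteq> topspace X \<and> X interior_of (X closure_of S) = {}"

definition non_meager_space :: "'a topology \<Rightarrow> bool" where
  "non_meager_space X \<longleftrightarrow>
     \<not> (\<exists>\<A>. countable \<A> \<and> (\<forall>S\<in>\<A>. nowhere_dense_in X S) \<and> topspace X = \<Union>\<A>)"

text \<open>Neighborhoods need not be open.\<close>

definition neighborhood_of :: "'a topology \<Rightarrow> 'a \<Rightarrow> 'a set \<Rightarrow> bool" where
  "neighborhood_of X x U \<longleftrightarrow> U \<subseteq> topspace X \<and> x \<in> X interior_of U"

definition topological_group :: "('g, 'm) monoid_scheme \<Rightarrow> 'g topology \<Rightarrow> bool" where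
  "topological_group G T \<longleftrightarrow>
     group G \<and> topspace T = carrier G \<and>
     continuous_map (prod_topology T T) T (\<lambda>(g, h). g \<otimes>\<^bsub>G\<^esub> h) \<and>
     continuous_map T T (\<lambda>g. inv\<^bsub>G\<^esub> g)"

definition continuous_action ::
  "('g, 'm) monoid_scheme \<Rightarrow> 'g topology \<Rightarrow> 'x topology \<Rightarrow> ('g \<Rightarrow> 'x \<Rightarrow> 'x) \<Rightarrow> bool" where
  "continuous_action G T X \<phi> \<longleftrightarrow>
     group_action G (topspace X) \<phi> \<and>
     continuous_map (prod_topology T X) X (\<lambda>(g, x). \<phi> g x)"

definition micro_transitive ::
  "('g, 'm) monoid_scheme \<Rightarrow> 'g topology \<Rightarrow> 'x topology \<Rightarrow> ('g \<Rightarrow> 'x \<Rightarrow> 'x) \<Rightarrow> bool" where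
  "micro_transitive G T X \<phi> \<longleftrightarrow>
     (\<forall>x\<in>topspace X. \<forall>U. neighborhood_of T \<one>\<^bsub>G\<^esub> U \<longrightarrow>
        neighborhood_of X x ((\<lambda>g. \<phi> g x) ` U))"

text \<open>
  HOL cannot quantify over all spaces of all types inside a definition. A separable metrizable
  space has at most continuum many points, so up to homeomorphism its points may be taken to be
  real numbers; \<open>X\<close> below carries an arbitrary topology on an arbitrary set of reals, in general
  unrelated to the usual topology of the reals. Nothing is lost: \<open>effros_arbitrary_space\<close> below
  extends the property to spaces \<open>X\<close> over any type. By the same cardinality bound, every separable
  metrizable group has a topologically isomorphic copy with elements in \<open>real\<close>.
\<close>

definition effros :: "('g, 'm) monoid_scheme \<Rightarrow> 'g topology \<Rightarrow> bool" where
  "effros G T \<longleftrightarrow>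
     (\<forall>(X :: real topology) \<phi>.
        separable_metrizable X \<and> non_meager_space X \<and>
        continuous_action G T X \<phi> \<and> transitive_action G (topspace X) \<phi> \<longrightarrow>
        micro_transitive G T X \<phi>)"

lemma separable_metrizable_lepoll_reals:
  assumes "separable_metrizable X"
  shows "topspace X \<lesssim> (UNIV :: real set)"
proof -
  from assms obtain M d where "Metric_space M d" and X: "X = Metric_space.mtopology M d"
    by (auto simp: separable_metrizable_def metrizable_space_def)
  interpret Metric_space M d by fact
  obtain C where C: "countable C" "C \<subseteq> M" "X closure_of C = M"
    using assms by (auto simp: separable_metrizable_def separable_space_def X)
  have inj: "inj_on (\<lambda>x. {(c, n). c \<in> C \<and> d x c < inverse (Suc n)}) M"
  proof (rule inj_onI, rule ccontr)
    fix x y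
    assume xy: "x \<in> M" "y \<in> M" "x \<noteq> y"
      and eq: "{(c, n). c \<in> C \<and> d x c < inverse (Suc n)}
             = {(c, n). c \<in> C \<and> d y c < inverse (Suc n)}"
    then have "d x y > 0" by simp
    then obtain n where n: "inverse (Suc n) < d x y / 2"
      using reals_Archimedean half_gt_zero by blast
    have "x \<in> X closure_of C" using C xy by simp
    then obtain c where c: "c \<in> C" "d x c < inverse (Suc n)"
      unfolding X metric_closure_of by (auto dest!: spec[of _ "inverse (real (Suc n))"])
    have "d y c < inverse (Suc n)" using eq c by blast
    moreover have "d x y \<le> d x c + d y c"
      using triangle[of x c y] xy c C commute[of y c] by auto
    ultimately show False using c n by linarith
  qed
  have "M \<lesssim> Pow (C \<times> (UNIV :: nat set))"
    unfolding lepoll_def by (rule exI, rule conjI[OF inj]) auto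
  also have "Pow (C \<times> (UNIV :: nat set)) \<lesssim> (UNIV :: nat set set)"
  proof -
    have "countable (C \<times> (UNIV :: nat set))" using C by simp
    then obtain e :: "'a \<times> nat \<Rightarrow> nat" where "inj_on e (C \<times> UNIV)" by (auto simp: countable_def)
    then show ?thesis
      unfolding lepoll_def by (intro exI[of _ "image e"] conjI inj_on_image_Pow) auto
  qed
  also have "(UNIV :: nat set set) \<lesssim> (UNIV :: real set)"
    using nat_sets_eqpoll_reals eqpoll_imp_lepoll by blast
  finally show ?thesis by (simp add: X)
qed

lemma nowhere_dense_in_homeomorphic_image:
  assumes "homeomorphic_map X Y f" "nowhere_dense_in X S"
  shows "nowhere_dense_in Y (f ` S)"
proof -
  have S: "S \<subseteq> topspace X" and e: "X interior_of (X closure_of S) = {}"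
    using assms(2) by (auto simp: nowhere_dense_in_def)
  have "f ` S \<subseteq> topspace Y"
    using S assms(1) homeomorphic_imp_surjective_map by blast
  moreover have "Y interior_of (Y closure_of (f ` S)) = {}"
    using homeomorphic_map_closure_of[OF assms(1) S]
      homeomorphic_map_interior_of[OF assms(1) closure_of_subset_topspace, of S] e by simp
  ultimately show ?thesis by (simp add: nowhere_dense_in_def)
qed

lemma neighborhood_of_homeomorphic_image:
  assumes "homeomorphic_map X Y f" "neighborhood_of X x U"
  shows "neighborhood_of Y (f x) (f ` U)"
proof -
  have U: "U \<subseteq> topspace X" and x: "x \<in> X interior_of U"
    using assms(2) by (auto simp: neighborhood_of_def)
  have "f ` U \<subseteq> topspace Y"
    using U assms(1) homeomorphic_imp_surjective_map by blast
  then show ?thesis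
    using x homeomorphic_map_interior_of[OF assms(1) U] by (simp add: neighborhood_of_def)
qed

lemma non_meager_space_homeomorphic:
  assumes "homeomorphic_map X Y f" "non_meager_space Y"
  shows "non_meager_space X"
  unfolding non_meager_space_def
proof
  assume "\<exists>\<A>. countable \<A> \<and> (\<forall>S\<in>\<A>. nowhere_dense_in X S) \<and> topspace X = \<Union>\<A>"
  then obtain \<A> where A: "countable \<A>" "\<forall>S\<in>\<A>. nowhere_dense_in X S" "topspace X = \<Union>\<A>"
    by (elim exE conjE) (rule that)
  have "countable ((`) f ` \<A>)" using A by simp
  moreover have "\<forall>S \<in> (`) f ` \<A>. nowhere_dense_in Y S"
    using A(2) nowhere_dense_in_homeomorphic_image[OF assms(1)] by (intro ballI) (erule imageE, simp)
  moreover have "topspace Y = \<Union>((`) f ` \<A>)"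
    unfolding homeomorphic_imp_surjective_map[OF assms(1), symmetric] A(3) by (rule image_Union)
  ultimately have "\<exists>\<B>. countable \<B> \<and> (\<forall>S\<in>\<B>. nowhere_dense_in Y S) \<and> topspace Y = \<Union>\<B>"
    by (intro exI conjI)
  with assms(2) show False
    unfolding non_meager_space_def by (rule notE)
qed

lemma group_action_transport:
  assumes "group_action G E \<phi>" and b: "bij_betw e E S" and i: "\<And>x. x \<in> E \<Longrightarrow> i (e x) = x"
  shows "group_action G S (\<lambda>g. \<lambda>y\<in>S. e (\<phi> g (i y)))"
proof -
  interpret group_action G E \<phi> by fact
  interpret gh: group_hom G "BijGroup E" \<phi> by (rule group_hom)
  let ?\<psi> = "\<lambda>g. \<lambda>y\<in>S. e (\<phi> g (i y))"
  have iS: "i y \<in> E" "e (i y) = y" if "y \<in> S" for y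
    using that b i by (auto simp: bij_betw_def)
  have bi: "bij_betw i S E"
    using b by (intro bij_betw_byWitness[where f' = e]) (auto simp: i iS bij_betw_def)
  have Bij: "?\<psi> g \<in> Bij S" if g: "g \<in> carrier G" for g
  proof -
    have "bij_betw (\<phi> g) E E" using bij_prop0[OF g] by (simp add: Bij_def)
    then have "bij_betw (e \<circ> (\<phi> g \<circ> i)) S S"
      by (rule bij_betw_trans[OF bij_betw_trans[OF bi] b])
    then have "bij_betw (?\<psi> g) S S"
      using bij_betw_cong[of S "?\<psi> g" "e \<circ> (\<phi> g \<circ> i)" S] by simp
    then show ?thesis by (simp add: Bij_def)
  qed
  have "?\<psi> (g \<otimes>\<^bsub>G\<^esub> h) = ?\<psi> g \<otimes>\<^bsub>BijGroup S\<^esub> ?\<psi> h"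
    if g: "g \<in> carrier G" and h: "h \<in> carrier G" for g h
  proof -
    have "?\<psi> (g \<otimes>\<^bsub>G\<^esub> h) = compose S (?\<psi> g) (?\<psi> h)"
    proof
      fix y
      show "?\<psi> (g \<otimes>\<^bsub>G\<^esub> h) y = compose S (?\<psi> g) (?\<psi> h) y"
      proof (cases "y \<in> S")
        case True
        then have "\<phi> h (i y) \<in> E" using element_image[OF h] iS by blast
        moreover from this have "e (\<phi> h (i y)) \<in> S" using b by (auto simp: bij_betw_def)
        ultimately show ?thesis
          using True composition_rule[OF iS(1)[OF True] g h] by (simp add: compose_def i)
      qed (simp add: compose_def)
    qed
    then show ?thesis using Bij[OF g] Bij[OF h] by (simp add: BijGroup_def)
  qed
  then have "?\<psi> \<in> hom G (BijGroup S)"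
    using Bij by (auto simp: hom_def BijGroup_def)
  then show ?thesis
    unfolding group_action_def group_hom_def group_hom_axioms_def
    using group_BijGroup gh.is_group by blast
qed

lemma effros_arbitrary_space:
  fixes X :: "'x topology"
  assumes "effros G T" and grp: "topological_group G T"
    and X: "separable_metrizable X" "non_meager_space X"
    and act: "continuous_action G T X \<phi>" "transitive_action G (topspace X) \<phi>"
  shows "micro_transitive G T X \<phi>"
proof -
  obtain e :: "'x \<Rightarrow> real" where inj: "inj_on e (topspace X)"
    using separable_metrizable_lepoll_reals[OF X(1)] by (auto simp: lepoll_def)
  define S where "S = e ` topspace X"
  define i where "i = inv_into (topspace X) e"
  define Y where "Y = pullback_topology S i X"
  define \<psi> where "\<psi> = (\<lambda>g. \<lambda>y\<in>S. e (\<phi> g (i y)))"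
  have ie: "i (e x) = x" if "x \<in> topspace X" for x
    using inj that by (simp add: i_def)
  have ei: "e (i y) = y" "i y \<in> topspace X" if "y \<in> S" for y
    using that ie by (auto simp: S_def)
  have Y: "topspace Y = S"
    using ei by (auto simp: Y_def topspace_pullback_topology)
  have cont_i: "continuous_map Y X i"
    using continuous_map_pullback[of X X id S i] by (simp add: Y_def)
  have cont_e: "continuous_map X Y e"
    unfolding Y_def
  proof (rule continuous_map_pullback')
    show "continuous_map X X (i \<circ> e)"
      by (rule continuous_map_eq[OF continuous_map_id]) (simp add: ie)
    show "topspace X \<subseteq> e -` S" by (auto simp: S_def)
  qed
  have maps: "homeomorphic_maps X Y e i"
    using cont_e cont_i ie ei by (simp add: homeomorphic_maps_def Y)
  then have hom_e: "homeomorphic_map X Y e" and hom_i: "homeomorphic_map Y X i"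
    using homeomorphic_maps_map by blast+
  have XY: "X homeomorphic_space Y"
    using maps by (auto simp: homeomorphic_space_def)
  have sm: "separable_metrizable Y"
    using X(1) homeomorphic_separable_space[OF XY] homeomorphic_metrizable_space[OF XY]
    by (simp add: separable_metrizable_def)
  have nm: "non_meager_space Y"
    by (rule non_meager_space_homeomorphic[OF hom_i X(2)])
  interpret transitive_action G "topspace X" \<phi> by (rule act(2))
  have GT: "topspace T = carrier G" using grp by (simp add: topological_group_def)
  have "bij_betw e (topspace X) S" using inj by (simp add: bij_betw_def S_def)
  then have ga: "group_action G S \<psi>"
    unfolding \<psi>_def using ie group_action_transport[OF group_action_axioms] by blast
  have ca: "continuous_action G T Y \<psi>"
  proof -
    have "continuous_map (prod_topology T Y) (prod_topology T X) (\<lambda>(g, y). (g, i y))"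
      using cont_i by (simp add: continuous_map_prod_top)
    moreover have "continuous_map (prod_topology T X) X (\<lambda>(g, x). \<phi> g x)"
      using act(1) by (simp add: continuous_action_def)
    ultimately have "continuous_map (prod_topology T Y) Y
        (e \<circ> ((\<lambda>(g, x). \<phi> g x) \<circ> (\<lambda>(g, y). (g, i y))))"
      by (intro continuous_map_compose[OF _ cont_e] continuous_map_compose)
    then have "continuous_map (prod_topology T Y) Y (\<lambda>(g, y). \<psi> g y)"
      by (rule continuous_map_eq) (auto simp: \<psi>_def Y)
    then show ?thesis using ga by (simp add: continuous_action_def Y)
  qed
  have "transitive_action G S \<psi>"
  proof (intro transitive_action.intro ga transitive_action_axioms.intro)
    fix y z assume yz: "y \<in> S" "z \<in> S"
    then obtain g where g: "g \<in> carrier G" "\<phi> g (i y) = i z"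
      using unique_orbit[OF ei(2) ei(2)] by blast
    then have "\<psi> g y = z"
      using yz by (simp add: \<psi>_def ei(1))
    then show "\<exists>g\<in>carrier G. \<psi> g y = z"
      using g(1) by blast
  qed
  then have mt: "micro_transitive G T Y \<psi>"
    using assms(1)[unfolded effros_def, rule_format, of Y \<psi>] sm nm ca unfolding Y by blast
  show ?thesis
    unfolding micro_transitive_def
  proof (intro ballI allI impI)
    fix x U assume x: "x \<in> topspace X" and U: "neighborhood_of T \<one>\<^bsub>G\<^esub> U"
    have exS: "e x \<in> S" using x by (simp add: S_def)
    have UG: "U \<subseteq> carrier G" using U by (simp add: neighborhood_of_def GT)
    have "neighborhood_of Y (e x) ((\<lambda>g. \<psi> g (e x)) ` U)"
      using mt U exS by (simp add: micro_transitive_def Y)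
    then have "neighborhood_of X (i (e x)) (i ` (\<lambda>g. \<psi> g (e x)) ` U)"
      by (rule neighborhood_of_homeomorphic_image[OF hom_i])
    moreover have "i ` (\<lambda>g. \<psi> g (e x)) ` U = (\<lambda>g. \<phi> g x) ` U"
      unfolding image_image
    proof (rule image_cong[OF refl])
      fix g assume "g \<in> U"
      then have "\<phi> g x \<in> topspace X"
        using UG x element_image[of g x] by blast
      then show "i (\<psi> g (e x)) = \<phi> g x"
        using exS x by (simp add: \<psi>_def ie)
    qed
    ultimately show "neighborhood_of X x ((\<lambda>g. \<phi> g x) ` U)"
      using ie[OF x] by simp
  qed
qed

end

theory Submission
  imports Defs
begin

text \<open>
  If a group carries separable metrizable group topologies \<open>\<tau>\<close> and \<open>\<sigma>\<close>, where \<open>\<tau>\<close> is strictly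
  finer than \<open>\<sigma>\<close> and \<open>\<sigma>\<close> is non-meager, then left translation of \<open>\<tau>\<close> on \<open>\<sigma>\<close> is a transitive
  continuous action that is not micro-transitive. Here the group is the additive group of the
  reals, \<open>\<sigma>\<close> is the usual topology, and \<open>\<tau>\<close> is the topology of the graph of a discontinuous
  additive function, obtained from a Hamel basis.
\<close>

section \<open>The additive group of a type as a monoid record\<close>

definition add_group :: "'a::ab_group_add monoid" where
  "add_group = \<lparr>carrier = UNIV, mult = (+), one = 0\<rparr>"

lemma add_group_simps [simp]:
  "carrier add_group = UNIV" "x \<otimes>\<^bsub>add_group\<^esub> y = x + y" "\<one>\<^bsub>add_group\<^esub> = 0"
  by (simp_all add: add_group_def)

lemma group_add_group: "group (add_group :: 'a::ab_group_add monoid)"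
proof (rule groupI)
  show "\<exists>y\<in>carrier add_group. y \<otimes>\<^bsub>add_group\<^esub> x = \<one>\<^bsub>add_group\<^esub>" for x :: 'a
    by (rule bexI[of _ "- x"]) auto
qed (auto simp: add.assoc)

lemma inv_add_group [simp]: "inv\<^bsub>add_group\<^esub> x = - x"
  using group.inv_equality[OF group_add_group, of "- x" x] by simp

section \<open>The graph topology: separable metrizable, and a group topology for additive
  maps\<close>

lemma continuous_map_euclidean_Pair:
  "continuous_map X euclidean (\<lambda>x. (g x, h x)) \<longleftrightarrow>
    continuous_map X euclidean g \<and> continuous_map X euclidean h"
proof
  assume "continuous_map X euclidean (\<lambda>x. (g x, h x))"
  then have "((\<lambda>x. (g x, h x)) \<longlongrightarrow> (g x, h x)) (atin X x)" if "x \<in> topspace X" for x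
    using that by (simp add: continuous_map_atin)
  then show "continuous_map X euclidean g \<and> continuous_map X euclidean h"
    using tendsto_fst[of "\<lambda>x. (g x, h x)"] tendsto_snd[of "\<lambda>x. (g x, h x)"]
    by (fastforce simp: continuous_map_atin)
qed (auto simp: continuous_map_atin intro: tendsto_Pair)

text \<open>This is the coarsest topology making both the identity and \<open>f\<close> continuous.
  Pulling back to the domain, instead of using the graph itself, lets the same group carry this
  topology and the usual one.\<close>

definition graph_topology :: "('a::topological_space \<Rightarrow> 'b::topological_space) \<Rightarrow> 'a topology" where
  "graph_topology f = pullback_topology UNIV (\<lambda>x. (x, f x)) euclidean"

lemma topspace_graph_topology [simp]: "topspace (graph_topology f) = UNIV"
  by (simp add: graph_topology_def topspace_pullback_topology)

lemma continuous_map_from_graph_topology: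
  "continuous_map (graph_topology f) euclidean (\<lambda>x. (x, f x))"
  using continuous_map_pullback[OF continuous_map_id, where A = UNIV and f = "\<lambda>x. (x, f x)" and ?T1.0 = euclidean]
  by (simp add: graph_topology_def o_def)

lemma continuous_map_graph_topology:
  "continuous_map (graph_topology f) euclidean (\<lambda>x. x)"
  "continuous_map (graph_topology f) euclidean f"
  using continuous_map_from_graph_topology[of f]
  by (simp_all add: continuous_map_euclidean_Pair)

lemma continuous_map_into_graph_topology:
  assumes "continuous_map X euclidean g" "continuous_map X euclidean (\<lambda>x. f (g x))"
  shows "continuous_map X (graph_topology f) g"
  unfolding graph_topology_def
  by (rule continuous_map_pullback')
    (use assms in \<open>auto simp: continuous_map_euclidean_Pair o_def\<close>)

lemma graph_topology_homeomorphic_space: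
  "graph_topology f homeomorphic_space subtopology euclidean (range (\<lambda>x. (x, f x)))"
proof -
  have "continuous_map (subtopology euclidean (range (\<lambda>x. (x, f x)))) (graph_topology f) fst"
  proof (rule continuous_map_into_graph_topology)
    have "continuous_on (range (\<lambda>x. (x, f x))) (\<lambda>p. f (fst p)) \<longleftrightarrow>
        continuous_on (range (\<lambda>x. (x, f x))) snd"
      by (rule continuous_on_cong) auto
    then show "continuous_map (subtopology euclidean (range (\<lambda>x. (x, f x)))) euclidean (\<lambda>p. f (fst p))"
      by (simp add: continuous_on_snd)
  qed (simp add: continuous_on_fst)
  then have "homeomorphic_maps (graph_topology f)
      (subtopology euclidean (range (\<lambda>x. (x, f x)))) (\<lambda>x. (x, f x)) fst"
    using continuous_map_from_graph_topology[of f]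
    by (auto simp: homeomorphic_maps_def continuous_map_in_subtopology)
  then show ?thesis
    unfolding homeomorphic_space_def by blast
qed

lemma second_countable_euclidean:
  "second_countable (euclidean :: 'a::second_countable_topology topology)"
proof -
  obtain B :: "'a set set" where B: "countable B" "topological_basis B"
    using ex_countable_basis by blast
  then show ?thesis
    unfolding second_countable_def open_openin [symmetric]
    by (metis topological_basis_open topological_basisE)
qed

lemma separable_metrizable_euclidean_subtopology:
  fixes S :: "'a::{metric_space,second_countable_topology} set"
  shows "separable_metrizable (subtopology euclidean S)"
  by (simp add: separable_metrizable_def metrizable_space_subtopology metrizable_space_euclidean
      second_countable_imp_separable_space second_countable_subtopology second_countable_euclidean)

lemma separable_metrizable_graph_topology:
  fixes f :: "'a::{metric_space,second_countable_topology} \<Rightarrow> 'b::{metric_space,second_countable_topology}"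
  shows "separable_metrizable (graph_topology f)"
  using separable_metrizable_euclidean_subtopology
    homeomorphic_separable_space[OF graph_topology_homeomorphic_space[of f]]
    homeomorphic_metrizable_space[OF graph_topology_homeomorphic_space[of f]]
  by (simp add: separable_metrizable_def)

lemma continuous_map_euclidean_add:
  fixes g h :: "'x \<Rightarrow> 'a::topological_monoid_add"
  assumes "continuous_map X euclidean g" "continuous_map X euclidean h"
  shows "continuous_map X euclidean (\<lambda>x. g x + h x)"
  using assms by (auto simp: continuous_map_atin tendsto_add)

text \<open>Continuity into the graph topology has to be checked for a map and for its composite
  with \<open>f\<close>. Additivity turns the composites for sum and negation into sums and
  negatives of maps already known to be continuous.\<close>

lemma topological_group_graph_topology:
  fixes f :: "'a::topological_ab_group_add \<Rightarrow> 'b::topological_ab_group_add"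
  assumes "Modules.additive f"
  shows "topological_group add_group (graph_topology f)"
proof -
  interpret Modules.additive f by fact
  let ?T = "graph_topology f"
  have fst: "continuous_map (prod_topology ?T ?T) euclidean (\<lambda>p. fst p)"
    "continuous_map (prod_topology ?T ?T) euclidean (\<lambda>p. f (fst p))"
    using continuous_map_graph_topology[of f]
      continuous_map_compose[OF continuous_map_fst, of ?T euclidean _ ?T] by (auto simp: o_def)
  have snd: "continuous_map (prod_topology ?T ?T) euclidean (\<lambda>p. snd p)"
    "continuous_map (prod_topology ?T ?T) euclidean (\<lambda>p. f (snd p))"
    using continuous_map_graph_topology[of f]
      continuous_map_compose[OF continuous_map_snd, of ?T euclidean _ ?T] by (auto simp: o_def)
  have "continuous_map (prod_topology ?T ?T) ?T (\<lambda>p. fst p + snd p)"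
    by (rule continuous_map_into_graph_topology)
      (auto simp: add intro!: continuous_map_euclidean_add fst snd)
  moreover have "continuous_map ?T ?T (\<lambda>x. - x)"
    using continuous_map_graph_topology[of f]
    by (intro continuous_map_into_graph_topology)
      (auto simp: minus continuous_map_atin tendsto_minus)
  ultimately show ?thesis
    by (simp add: topological_group_def group_add_group case_prod_unfold)
qed

section \<open>Translation on the usual topology, and what micro-transitivity would force\<close>

lemma transitive_action_translation:
  "transitive_action (add_group :: 'a::ab_group_add monoid) UNIV (+)"
proof -
  have bij: "(+) g \<in> Bij UNIV" for g :: 'a
    by (simp add: Bij_def)
  then have "(+) \<in> hom (add_group :: 'a monoid) (BijGroup UNIV)"
    by (auto simp: hom_def BijGroup_def compose_def add.assoc)
  then have "group_action (add_group :: 'a monoid) UNIV (+)"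
    by (simp add: group_action_def group_hom_def group_hom_axioms_def group_add_group group_BijGroup)
  moreover have "\<exists>g\<in>carrier add_group. g + x = y" for x y :: 'a
    by (rule bexI[of _ "y - x"]) auto
  ultimately show ?thesis
    by (simp add: transitive_action_def transitive_action_axioms_def)
qed

text \<open>The graph topology refines the usual one, so addition stays continuous when its first
  argument is taken in the graph topology.\<close>

lemma continuous_action_translation:
  fixes f :: "'a::topological_ab_group_add \<Rightarrow> 'b::topological_space"
  shows "continuous_action add_group (graph_topology f) (euclidean :: 'a topology) (+)"
proof -
  have "continuous_map (prod_topology (graph_topology f) euclidean) euclidean (\<lambda>p. fst p + snd p)"
    using continuous_map_compose[OF continuous_map_fst continuous_map_graph_topology(1), of f euclidean]
      continuous_map_snd[of "graph_topology f" euclidean]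
    by (intro continuous_map_euclidean_add) (simp_all add: o_def)
  then show ?thesis
    using transitive_action_translation[where 'a = 'a]
    by (simp add: continuous_action_def transitive_action_def case_prod_unfold)
qed

lemma non_meager_space_completely_metrizable:
  assumes "completely_metrizable_space X" "topspace X \<noteq> {}"
  shows "non_meager_space X"
  unfolding non_meager_space_def
proof
  assume "\<exists>\<A>. countable \<A> \<and> (\<forall>S\<in>\<A>. nowhere_dense_in X S) \<and> topspace X = \<Union>\<A>"
  then obtain \<A> where A: "countable \<A>" "\<forall>S\<in>\<A>. nowhere_dense_in X S" "topspace X = \<Union>\<A>"
    by (elim exE conjE) (rule that)
  \<comment> \<open>The Baire category theorem is applied to the closures, which are closed with
    empty interior and still cover the space.\<close>
  have "X interior_of \<Union>((closure_of) X ` \<A>) = {}"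
    using assms(1) A(1,2) by (intro Baire_category_alt) (auto simp: nowhere_dense_in_def)
  moreover have "\<Union>((closure_of) X ` \<A>) = topspace X"
  proof
    show "\<Union>((closure_of) X ` \<A>) \<subseteq> topspace X"
      by (simp add: UN_least closure_of_subset_topspace)
    have "S \<subseteq> (closure_of) X S" if "S \<in> \<A>" for S
      using bspec[OF A(2) that] by (simp add: nowhere_dense_in_def closure_of_subset)
    then show "topspace X \<subseteq> \<Union>((closure_of) X ` \<A>)"
      unfolding A(3) by blast
  qed
  ultimately show False
    using assms(2) by simp
qed

text \<open>The orbit map at \<open>0\<close> of the translation action is the identity from the graph topology to the
  usual one, so micro-transitivity makes \<open>{x. norm (f x) < 1}\<close> a neighborhood of \<open>0\<close>.\<close>

lemma effros_graph_topology_bounded_near_0: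
  fixes f :: "real \<Rightarrow> 'b::real_normed_vector"
  assumes "effros add_group (graph_topology f)" "f 0 = 0"
  obtains e where "e > 0" "\<And>x. \<bar>x\<bar> < e \<Longrightarrow> norm (f x) < 1"
proof -
  let ?U = "{x. norm (f x) < 1}"
  have "separable_metrizable (euclidean :: real topology)"
    using separable_metrizable_euclidean_subtopology[of UNIV] by simp
  moreover have "non_meager_space (euclidean :: real topology)"
    by (simp add: non_meager_space_completely_metrizable completely_metrizable_space_euclidean)
  ultimately have mt: "micro_transitive add_group (graph_topology f) (euclidean :: real topology) (+)"
    using assms(1) continuous_action_translation[of f] transitive_action_translation[where 'a = real]
    by (simp add: effros_def)
  have "openin (graph_topology f) {x \<in> topspace (graph_topology f). f x \<in> ball 0 1}"
    by (rule openin_continuous_map_preimage[OF continuous_map_graph_topology(2)]) simp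
  then have "graph_topology f interior_of ?U = ?U"
    by (simp add: interior_of_openin)
  then have "neighborhood_of (graph_topology f) \<one>\<^bsub>add_group\<^esub> ?U"
    using assms(2) by (simp add: neighborhood_of_def)
  then have "neighborhood_of euclidean 0 ((\<lambda>g. g + 0) ` ?U)"
    using mt by (simp only: micro_transitive_def topspace_euclidean) blast
  then have "0 \<in> interior ?U"
    by (simp add: neighborhood_of_def)
  then obtain e where "e > 0" "ball 0 e \<subseteq> ?U"
    by (auto simp: mem_interior)
  then show ?thesis
    by (intro that[of e]) (auto simp: subset_iff)
qed

section \<open>Additive functions on the reals: a wild one and a criterion for linearity\<close>

text \<open>Extend 1 to a basis of the reals over the rationals, which is where choice enters, and
  take the coefficient of the basis vector 1.\<close>

lemma ex_rat_valued_additive: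
  obtains f :: "real \<Rightarrow> real" where "Modules.additive f" "f 1 = 1" "range f \<subseteq> \<rat>"
proof -
  interpret rat_vs: vector_space "\<lambda>(q::rat) (x::real). of_rat q * x"
    by unfold_locales (simp_all add: algebra_simps of_rat_add of_rat_mult)
  have ind: "rat_vs.independent {1}"
    by (simp add: rat_vs.dependent_single)
  define B where "B = rat_vs.extend_basis {1}"
  have B: "rat_vs.independent B" "rat_vs.span B = UNIV" "1 \<in> B"
    using rat_vs.independent_extend_basis[OF ind] rat_vs.span_extend_basis[OF ind]
      rat_vs.extend_basis_superset[OF ind] by (auto simp: B_def)
  let ?f = "\<lambda>x. of_rat (rat_vs.representation B x 1) :: real"
  have "Modules.additive ?f"
    by (rule additive.intro) (simp add: B rat_vs.representation_add of_rat_add)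
  moreover have "?f 1 = 1"
    using B by (simp add: rat_vs.representation_basis)
  moreover have "range ?f \<subseteq> \<rat>"
    by auto
  ultimately show ?thesis
    by (rule that)
qed

text \<open>The additive map \<open>f x - x * f 1\<close> vanishes on the rationals. Translating by
  rationals spreads its bound near 0 to the whole line, and a bounded additive map is zero.\<close>

lemma additive_bounded_near_0_imp_linear:
  fixes f :: "real \<Rightarrow> real"
  assumes "Modules.additive f" and e: "e > 0" "\<And>x. \<bar>x\<bar> < e \<Longrightarrow> \<bar>f x\<bar> < 1"
  shows "f x = x * f 1"
proof -
  interpret Modules.additive f by fact
  have nat: "f (of_nat n * y) = of_nat n * f y" for n y
    by (induction n) (simp_all add: zero add algebra_simps)
  have int: "f (of_int k * y) = of_int k * f y" for k y
    by (cases k rule: int_cases2) (simp_all add: nat minus)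
  have rat: "f q = q * f 1" if "q \<in> \<rat>" for q
  proof -
    obtain a b :: int where ab: "b > 0" "q = of_int a / of_int b"
      using \<open>q \<in> \<rat>\<close> by (rule Rats_cases') (rule that)
    have "of_int b * f q = of_int b * (q * f 1)"
      using ab int[of b q] int[of a 1] by simp
    then show ?thesis
      using ab(1) by simp
  qed
  have bound: "of_nat n * \<bar>f x - x * f 1\<bar> \<le> 1 + e * \<bar>f 1\<bar>" if "n > 0" for n
  proof -
    \<comment> \<open>The rational is chosen so close to \<open>x\<close> that even the
      \<open>n\<close>-fold difference stays in the interval where \<open>f\<close> is
      bounded.\<close>
    obtain q where q: "q \<in> \<rat>" "x < q" "q < x + e / of_nat n"
      using Rats_dense_in_real[of x "x + e / of_nat n"] e(1) \<open>n > 0\<close> by auto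
    let ?y = "of_nat n * (x - q)"
    have y: "\<bar>?y\<bar> < e"
      using q \<open>n > 0\<close> by (simp add: abs_mult field_simps)
    have "of_nat n * (f x - x * f 1) = f ?y - ?y * f 1"
      unfolding nat diff rat[OF q(1)] by (simp add: algebra_simps)
    then have "of_nat n * \<bar>f x - x * f 1\<bar> = \<bar>f ?y - ?y * f 1\<bar>"
      by (metis abs_mult abs_of_nat)
    also have "\<dots> \<le> \<bar>f ?y\<bar> + \<bar>?y\<bar> * \<bar>f 1\<bar>"
      by (metis abs_mult abs_triangle_ineq4)
    also have "\<dots> \<le> 1 + e * \<bar>f 1\<bar>"
      using e(2)[OF y] y by (intro add_mono mult_right_mono) auto
    finally show ?thesis .
  qed
  have "\<bar>f x - x * f 1\<bar> = 0"
  proof (rule ccontr)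
    assume "\<bar>f x - x * f 1\<bar> \<noteq> 0"
    then obtain n where "1 + e * \<bar>f 1\<bar> < of_nat n * \<bar>f x - x * f 1\<bar>"
      using reals_Archimedean3[of "\<bar>f x - x * f 1\<bar>"] by auto
    moreover have "0 \<le> e * \<bar>f 1\<bar>"
      using e(1) by simp
    \<comment> \<open>The bound requires \<open>n > 0\<close>; for \<open>n = 0\<close> the
      Archimedean inequality would already put a positive number below 0.\<close>
    ultimately show False
      using bound[of n] by (cases "n = 0") auto
  qed
  then show ?thesis
    by simp
qed

theorem corollary3p2:
  shows "\<exists>(G :: real monoid) (T :: real topology).
           topological_group G T \<and> separable_metrizable T \<and> \<not> effros G T"
proof -
  obtain f :: "real \<Rightarrow> real" where f: "Modules.additive f" "f 1 = 1" "range f \<subseteq> \<rat>"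
    by (rule ex_rat_valued_additive)
  have "\<not> effros add_group (graph_topology f)"
  proof
    assume "effros add_group (graph_topology f)"
    then obtain e where "e > 0" "\<And>x. \<bar>x\<bar> < e \<Longrightarrow> norm (f x) < 1"
      using effros_graph_topology_bounded_near_0 additive.zero[OF f(1)] by blast
    \<comment> \<open>Linearity and \<open>f 1 = 1\<close> make \<open>f\<close> the identity, whose
      range cannot lie in the countable set of rationals.\<close>
    then have "f x = x" for x
      using additive_bounded_near_0_imp_linear[OF f(1), of e x] f(2) by simp
    then have "(UNIV :: real set) \<subseteq> \<rat>"
      using f(3) by auto
    then show False
      using countable_rat countable_subset uncountable_UNIV_real by blast
  qed
  then show ?thesis
    using topological_group_graph_topology[OF f(1)] separable_metrizable_graph_topology[of f] by blast
qed

end
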